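(* Let $\mathbb{F}$ be a field and let $\mathcal{A}$ be a nonzero finite dimensional algebra over $\mathbb{F}$ (not assumed to have a unity). Then $\mathcal{A}$ is prime if and only if there exist a positive integer $n$ and a division algebra $\mathcal{D}$ over $\mathbb{F}$ such that $\mathcal{A}\cong M_n(\mathcal{D})$.
   Context: An algebra over a field $\mathbb{F}$ is an $\mathbb{F}$-vector space with a bilinear associative multiplication; it is not required to have a unity. A unity of an algebra $\mathcal{A}$ is a nonzero element $1_{\mathcal{A}}\in\mathcal{A}$ with $1_{\mathcal{A}}a=a1_{\mathcal{A}}=a$ for all $a\in\mathcal{A}$. An algebra is nonzero if it contains a nonzero element, and finite dimensional if it is finite dimensional as an $\mathbb{F}$-vector space. A division algebra is an algebra with unity in which every nonzero element is invertible. $M_n(\mathcal{D})$ is the $\mathbb{F}$-algebra of $n\times n$ matrices with entries in $\mathcal{D}$ under the standard matrix operations. $\mathcal{A}\cong\mathcal{B}$ means that there is a bijective $\mathbb{F}$-linear map $\varphi:\mathcal{A}\to\mathcal{B}$ with $\varphi(ab)=\varphi(a)\varphi(b)$ for all $a,b\in\mathcal{A}$. An algebra $\mathcal{A}$ is prime if for all $a,b\in\mathcal{A}$, $a\mathcal{A}b=\{0\}$ implies $a=0$ or $b=0$, where $a\mathcal{A}b=\{axb\mid x\in\mathcal{A}\}$. *)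

theory Defs
  imports "Jordan_Normal_Form.Missing_VectorSpace" "HOL-Library.FuncSet"
begin

text \<open>
  Algebras over a field that need not have a unity. The operations are those of the record type
  \<open>module\<close>, whose \<open>one\<close> field is unconstrained here and carries no information.
  (The locale \<open>algebra\<close> of HOL-Algebra is for commutative algebras with unity.)
\<close>

locale assoc_algebra = vectorspace F A for F and A +
  assumes amult_closed:
      "\<lbrakk>x \<in> carrier A; y \<in> carrier A\<rbrakk> \<Longrightarrow> x \<otimes>\<^bsub>A\<^esub> y \<in> carrier A"
    and amult_assoc:
      "\<lbrakk>x \<in> carrier A; y \<in> carrier A; z \<in> carrier A\<rbrakk> \<Longrightarrow>
       (x \<otimes>\<^bsub>A\<^esub> y) \<otimes>\<^bsub>A\<^esub> z = x \<otimes>\<^bsub>A\<^esub> (y \<otimes>\<^bsub>A\<^esub> z)"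
    and amult_add_left:
      "\<lbrakk>x \<in> carrier A; y \<in> carrier A; z \<in> carrier A\<rbrakk> \<Longrightarrow>
       (x \<oplus>\<^bsub>A\<^esub> y) \<otimes>\<^bsub>A\<^esub> z = (x \<otimes>\<^bsub>A\<^esub> z) \<oplus>\<^bsub>A\<^esub> (y \<otimes>\<^bsub>A\<^esub> z)"
    and amult_add_right:
      "\<lbrakk>x \<in> carrier A; y \<in> carrier A; z \<in> carrier A\<rbrakk> \<Longrightarrow>
       x \<otimes>\<^bsub>A\<^esub> (y \<oplus>\<^bsub>A\<^esub> z) = (x \<otimes>\<^bsub>A\<^esub> y) \<oplus>\<^bsub>A\<^esub> (x \<otimes>\<^bsub>A\<^esub> z)"
    and amult_smult_left:
      "\<lbrakk>c \<in> carrier F; x \<in> carrier A; y \<in> carrier A\<rbrakk> \<Longrightarrow>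
       (c \<odot>\<^bsub>A\<^esub> x) \<otimes>\<^bsub>A\<^esub> y = c \<odot>\<^bsub>A\<^esub> (x \<otimes>\<^bsub>A\<^esub> y)"
    and amult_smult_right:
      "\<lbrakk>c \<in> carrier F; x \<in> carrier A; y \<in> carrier A\<rbrakk> \<Longrightarrow>
       x \<otimes>\<^bsub>A\<^esub> (c \<odot>\<^bsub>A\<^esub> y) = c \<odot>\<^bsub>A\<^esub> (x \<otimes>\<^bsub>A\<^esub> y)"

text \<open>
  In an algebra with unity, the unity is the \<open>one\<close> field, as in the locale \<open>ring\<close>.
\<close>

definition division_algebra ::
    "('f, 'm) ring_scheme \<Rightarrow> ('f, 'd, 'e) module_scheme \<Rightarrow> bool" where
  "division_algebra F D \<longleftrightarrow>
     assoc_algebra F D \<and> ring D \<and> \<one>\<^bsub>D\<^esub> \<noteq> \<zero>\<^bsub>D\<^esub> \<and>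
     (\<forall>a \<in> carrier D. a \<noteq> \<zero>\<^bsub>D\<^esub> \<longrightarrow> a \<in> Units D)"

definition prime_algebra :: "('f, 'a, 'e) module_scheme \<Rightarrow> bool" where
  "prime_algebra A \<longleftrightarrow>
     (\<forall>a \<in> carrier A. \<forall>b \<in> carrier A.
        {a \<otimes>\<^bsub>A\<^esub> x \<otimes>\<^bsub>A\<^esub> b | x. x \<in> carrier A} = {\<zero>\<^bsub>A\<^esub>} \<longrightarrow> a = \<zero>\<^bsub>A\<^esub> \<or> b = \<zero>\<^bsub>A\<^esub>)"

text \<open>
  A matrix is a function on the index pairs below \<open>n\<close>, with the value \<open>undefined\<close>
  outside the index set, so that equality of matrices is equality of functions.
\<close>

definition matrix_algebra ::
    "nat \<Rightarrow> ('f, 'd, 'e) module_scheme \<Rightarrow> ('f, nat \<times> nat \<Rightarrow> 'd) module" where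
  "matrix_algebra n D =
     \<lparr>carrier = ({..<n} \<times> {..<n}) \<rightarrow>\<^sub>E carrier D,
      mult = (\<lambda>M N. \<lambda>(i, j) \<in> {..<n} \<times> {..<n}. \<Oplus>\<^bsub>D\<^esub>k\<in>{..<n}. M (i, k) \<otimes>\<^bsub>D\<^esub> N (k, j)),
      one = (\<lambda>(i, j) \<in> {..<n} \<times> {..<n}. if i = j then \<one>\<^bsub>D\<^esub> else \<zero>\<^bsub>D\<^esub>),
      zero = (\<lambda>p \<in> {..<n} \<times> {..<n}. \<zero>\<^bsub>D\<^esub>),
      add = (\<lambda>M N. \<lambda>p \<in> {..<n} \<times> {..<n}. M p \<oplus>\<^bsub>D\<^esub> N p),
      smult = (\<lambda>c M. \<lambda>p \<in> {..<n} \<times> {..<n}. c \<odot>\<^bsub>D\<^esub> M p)\<rparr>"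

definition algebra_isomorphic ::
    "('f, 'm) ring_scheme \<Rightarrow> ('f, 'a, 'e) module_scheme \<Rightarrow> ('f, 'b, 'k) module_scheme \<Rightarrow> bool" where
  "algebra_isomorphic F A B \<longleftrightarrow>
     (\<exists>\<phi> \<in> module_hom F A B. bij_betw \<phi> (carrier A) (carrier B) \<and>
        (\<forall>a \<in> carrier A. \<forall>b \<in> carrier A. \<phi> (a \<otimes>\<^bsub>A\<^esub> b) = \<phi> a \<otimes>\<^bsub>B\<^esub> \<phi> b))"

end

theory Submission
  imports Defs
begin

text \<open>
  A minimal left ideal of a prime finite dimensional algebra \<open>A\<close> contains an idempotent \<open>e\<close> for
  which \<open>D = eAe\<close> is a division algebra. By primeness the pairing \<open>eA \<times> Ae \<rightarrow> D\<close>, \<open>(u, v) \<mapsto> uv\<close>, is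
  nondegenerate, so dual systems \<open>u\<^sub>i \<in> eA\<close>, \<open>v\<^sub>j \<in> Ae\<close> with \<open>u\<^sub>i v\<^sub>j = \<delta>\<^sub>i\<^sub>j e\<close> can be extended as long as
  \<open>f = \<Sum>\<^sub>k v\<^sub>k u\<^sub>k\<close> does not fix \<open>Ae\<close>; their length is bounded by the dimension of \<open>A\<close>. For a maximal
  one, \<open>f\<close> is a unity of \<open>A\<close>, and \<open>a \<mapsto> (u\<^sub>i a v\<^sub>j)\<close> is an isomorphism onto the matrices over \<open>D\<close> with
  inverse \<open>M \<mapsto> \<Sum> v\<^sub>i M\<^sub>i\<^sub>j u\<^sub>j\<close>. Conversely, matrix units show that matrices over a division algebra form
  a prime algebra.
\<close>

section \<open>Independence counts and minimal subspaces\<close>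

text \<open>Here \<open>d W\<close> plays the role of the dimension of \<open>W\<close>. An
  independent \<open>B\<close> attaining it has its span inside the subspace \<open>W\<close>, so
  adding a vector of \<open>W'\<close> outside \<open>W\<close> keeps it independent.\<close>

lemma (in vectorspace) max_independent_card_less:
  assumes fd: "fin_dim" and W: "submodule K W V" and W': "W' \<subseteq> carrier V" and lt: "W \<subset> W'"
  defines "d \<equiv> \<lambda>W. Max {card B | B. B \<subseteq> W \<and> lin_indpt B}"
  shows "d W < d W'"
proof -
  have WV: "W \<subseteq> carrier V"
    using W by (simp add: submodule_def)
  \<comment> \<open>\<open>Max\<close> is meaningful only on a finite set; \<open>dim\<close> bounds
    all the cardinalities.\<close>
  have fin: "finite {card B | B. B \<subseteq> U \<and> lin_indpt B}" if "U \<subseteq> carrier V" for U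
    by (rule finite_subset[of _ "{..dim}"]) (use that li_le_dim(2)[OF fd] in auto)
  have "lin_indpt {}"
    by (auto simp: lin_dep_def)
  then have "d W \<in> {card B | B. B \<subseteq> W \<and> lin_indpt B}"
    unfolding d_def using fin[OF WV] by (intro Max_in) auto
  then obtain B where B: "B \<subseteq> W" "lin_indpt B" "d W = card B"
    by auto
  have finB: "finite B"
    using li_le_dim(1)[OF fd] B WV by blast
  obtain w where w: "w \<in> W'" "w \<notin> W"
    using lt by blast
  have "span B \<subseteq> W"
    using span_is_subset[OF B(1) W] .
  then have "lin_indpt (B \<union> {w})"
    using lin_dep_iff_in_span[of B w] B w W' WV by blast
  moreover have "B \<union> {w} \<subseteq> W'"
    using B w lt by blast
  ultimately have "card (B \<union> {w}) \<le> d W'"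
    unfolding d_def using fin[OF W'] by (intro Max_ge) auto
  moreover have "card (B \<union> {w}) = Suc (card B)"
    using card_insert_disjoint[OF finB, of w] B(1) w(2) by auto
  ultimately show ?thesis
    using B by simp
qed

text \<open>A member with the least value of \<open>?d\<close> is minimal, because a member properly
  inside it would have a smaller value.\<close>

lemma (in vectorspace) minimal_submodule_exists:
  assumes fd: "fin_dim" and sub: "\<And>W. W \<in> \<W> \<Longrightarrow> submodule K W V" and W0: "W0 \<in> \<W>"
  shows "\<exists>L \<in> \<W>. \<forall>W \<in> \<W>. W \<subseteq> L \<longrightarrow> W = L"
proof -
  let ?d = "\<lambda>W. Max {card B | B. B \<subseteq> W \<and> lin_indpt B}"
  obtain L where L: "L \<in> \<W>" "\<And>W. W \<in> \<W> \<Longrightarrow> ?d L \<le> ?d W"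
    using ex_has_least_nat[of "\<lambda>W. W \<in> \<W>" W0 ?d] W0 by auto
  have "W = L" if W: "W \<in> \<W>" "W \<subseteq> L" for W
  proof (rule ccontr)
    assume "W \<noteq> L"
    then have "?d W < ?d L"
      using max_independent_card_less[OF fd sub[OF W(1)], of L] W sub[OF L(1)] by (auto simp: submodule_def)
    then show False
      using L(2)[OF W(1)] by simp
  qed
  then show ?thesis
    using L by blast
qed

section \<open>Arithmetic of algebras without unity\<close>

context assoc_algebra
begin

abbreviation amul (infixl "\<cdot>" 70)
  where "x \<cdot> y \<equiv> x \<otimes>\<^bsub>A\<^esub> y"

declare amult_closed [simp]

lemma amult_zero_left [simp]: "x \<in> carrier A \<Longrightarrow> \<zero>\<^bsub>A\<^esub> \<cdot> x = \<zero>\<^bsub>A\<^esub>"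
  using amult_add_left[of "\<zero>\<^bsub>A\<^esub>" "\<zero>\<^bsub>A\<^esub>" x] by (metis M.add.r_cancel_one' M.l_zero M.zero_closed amult_closed)

lemma amult_zero_right [simp]: "x \<in> carrier A \<Longrightarrow> x \<cdot> \<zero>\<^bsub>A\<^esub> = \<zero>\<^bsub>A\<^esub>"
  using amult_add_right[of x "\<zero>\<^bsub>A\<^esub>" "\<zero>\<^bsub>A\<^esub>"] by (metis M.add.r_cancel_one' M.l_zero M.zero_closed amult_closed)

lemma amult_neg_left:
  "\<lbrakk>x \<in> carrier A; y \<in> carrier A\<rbrakk> \<Longrightarrow> (\<ominus>\<^bsub>A\<^esub> x) \<cdot> y = \<ominus>\<^bsub>A\<^esub> (x \<cdot> y)"
  using amult_add_left[of x "\<ominus>\<^bsub>A\<^esub> x" y]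
  by (metis M.add.inv_closed M.minus_equality M.l_neg amult_add_left amult_closed amult_zero_left)

lemma amult_neg_right:
  "\<lbrakk>x \<in> carrier A; y \<in> carrier A\<rbrakk> \<Longrightarrow> x \<cdot> (\<ominus>\<^bsub>A\<^esub> y) = \<ominus>\<^bsub>A\<^esub> (x \<cdot> y)"
  by (metis M.add.inv_closed M.minus_equality M.l_neg amult_add_right amult_closed amult_zero_right)

lemma amult_diff_left:
  "\<lbrakk>x \<in> carrier A; y \<in> carrier A; z \<in> carrier A\<rbrakk> \<Longrightarrow> (x \<ominus>\<^bsub>A\<^esub> y) \<cdot> z = x \<cdot> z \<ominus>\<^bsub>A\<^esub> y \<cdot> z"
  by (simp add: a_minus_def amult_add_left amult_neg_left)

lemma amult_diff_right:
  "\<lbrakk>x \<in> carrier A; y \<in> carrier A; z \<in> carrier A\<rbrakk> \<Longrightarrow> x \<cdot> (y \<ominus>\<^bsub>A\<^esub> z) = x \<cdot> y \<ominus>\<^bsub>A\<^esub> x \<cdot> z"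
  by (simp add: a_minus_def amult_add_right amult_neg_right)

lemma finsum_amult_left:
  "\<lbrakk>finite I; g \<in> I \<rightarrow> carrier A; x \<in> carrier A\<rbrakk> \<Longrightarrow>
   x \<cdot> (\<Oplus>\<^bsub>A\<^esub>i\<in>I. g i) = (\<Oplus>\<^bsub>A\<^esub>i\<in>I. x \<cdot> g i)"
  by (induction I rule: finite_induct)
    (auto simp: Pi_def amult_add_right M.finsum_insert M.finsum_closed)

lemma finsum_amult_right:
  "\<lbrakk>finite I; g \<in> I \<rightarrow> carrier A; x \<in> carrier A\<rbrakk> \<Longrightarrow>
   (\<Oplus>\<^bsub>A\<^esub>i\<in>I. g i) \<cdot> x = (\<Oplus>\<^bsub>A\<^esub>i\<in>I. g i \<cdot> x)"
  by (induction I rule: finite_induct)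
    (auto simp: Pi_def amult_add_left M.finsum_insert M.finsum_closed)

lemma diff_eq_zero_iff:
  "\<lbrakk>x \<in> carrier A; y \<in> carrier A\<rbrakk> \<Longrightarrow> x \<ominus>\<^bsub>A\<^esub> y = \<zero>\<^bsub>A\<^esub> \<longleftrightarrow> x = y"
  by (metis M.add.inv_closed M.minus_equality M.minus_minus M.r_neg a_minus_def)

text \<open>The set \<open>aAb\<close> always contains zero, from \<open>x = 0\<close>, so if it
  differs from the zero set it has a nonzero member.\<close>

lemma primeE:
  assumes "prime_algebra A" "a \<in> carrier A" "b \<in> carrier A" "a \<noteq> \<zero>\<^bsub>A\<^esub>" "b \<noteq> \<zero>\<^bsub>A\<^esub>"
  obtains x where "x \<in> carrier A" "a \<cdot> x \<cdot> b \<noteq> \<zero>\<^bsub>A\<^esub>"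
proof -
  have "{a \<cdot> x \<cdot> b | x. x \<in> carrier A} \<noteq> {\<zero>\<^bsub>A\<^esub>}"
    using assms unfolding prime_algebra_def by blast
  moreover have "\<zero>\<^bsub>A\<^esub> \<in> {a \<cdot> x \<cdot> b | x. x \<in> carrier A}"
    using assms by (auto intro!: exI[of _ "\<zero>\<^bsub>A\<^esub>"])
  ultimately show thesis
    using that by blast
qed

section \<open>Left ideals and a division corner\<close>

text \<open>In the absence of a unity, closure under left multiplication does not give closure under
  scalars, so being a subspace is demanded separately.\<close>

definition left_ideal :: "'c set \<Rightarrow> bool" where
  "left_ideal L \<longleftrightarrow> submodule F L A \<and> (\<forall>a \<in> carrier A. \<forall>x \<in> L. a \<cdot> x \<in> L)"

lemma left_idealD:
  assumes "left_ideal L"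
  shows "x \<in> L \<Longrightarrow> x \<in> carrier A" "\<zero>\<^bsub>A\<^esub> \<in> L" "\<lbrakk>x \<in> L; y \<in> L\<rbrakk> \<Longrightarrow> x \<oplus>\<^bsub>A\<^esub> y \<in> L"
    "\<lbrakk>c \<in> carrier F; x \<in> L\<rbrakk> \<Longrightarrow> c \<odot>\<^bsub>A\<^esub> x \<in> L" "\<lbrakk>a \<in> carrier A; x \<in> L\<rbrakk> \<Longrightarrow> a \<cdot> x \<in> L"
  using assms by (auto simp: left_ideal_def submodule_def)

lemma left_ideal_neg: "\<lbrakk>left_ideal L; x \<in> L\<rbrakk> \<Longrightarrow> \<ominus>\<^bsub>A\<^esub> x \<in> L"
  by (metis left_idealD(1,4) R.add.inv_closed R.one_closed smult_minus_1)

lemma left_ideal_diff: "\<lbrakk>left_ideal L; x \<in> L; y \<in> L\<rbrakk> \<Longrightarrow> x \<ominus>\<^bsub>A\<^esub> y \<in> L"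
  by (simp add: a_minus_def left_idealD(3) left_ideal_neg)

lemma left_ideal_carrier: "left_ideal (carrier A)"
  unfolding left_ideal_def submodule_def by (auto simp: module_axioms)

text \<open>Right multiplication by \<open>u\<close> commutes with left multiplications, so it maps
  left ideals to left ideals. Minimality is later applied both to this image and to the kernel
  treated next.\<close>

lemma left_ideal_image_right_mult:
  assumes L: "left_ideal L" and u: "u \<in> carrier A"
  shows "left_ideal ((\<lambda>x. x \<cdot> u) ` L)"
  unfolding left_ideal_def submodule_def
proof (intro conjI ballI allI impI)
  note [simp] = left_idealD[OF L]
  show "Module.module F A"
    by (rule module_axioms)
  show "(\<lambda>x. x \<cdot> u) ` L \<subseteq> carrier A"
    using u by auto
  show "v \<oplus>\<^bsub>A\<^esub> w \<in> (\<lambda>x. x \<cdot> u) ` L" if "v \<in> (\<lambda>x. x \<cdot> u) ` L" "w \<in> (\<lambda>x. x \<cdot> u) ` L" for v w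
    using that u by (auto simp flip: amult_add_left)
  show "\<zero>\<^bsub>A\<^esub> \<in> (\<lambda>x. x \<cdot> u) ` L"
    using u by (auto intro!: image_eqI[of _ _ "\<zero>\<^bsub>A\<^esub>"])
  show "c \<odot>\<^bsub>A\<^esub> v \<in> (\<lambda>x. x \<cdot> u) ` L" if "c \<in> carrier F" "v \<in> (\<lambda>x. x \<cdot> u) ` L" for c v
    using that u by (auto simp flip: amult_smult_left)
  show "a \<cdot> v \<in> (\<lambda>x. x \<cdot> u) ` L" if "a \<in> carrier A" "v \<in> (\<lambda>x. x \<cdot> u) ` L" for a v
    using that u by (auto simp flip: amult_assoc)
qed

lemma left_ideal_annihilator:
  assumes L: "left_ideal L" and u: "u \<in> carrier A"
  shows "left_ideal {x \<in> L. x \<cdot> u = \<zero>\<^bsub>A\<^esub>}"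
  unfolding left_ideal_def submodule_def
  using u left_idealD[OF L] by (auto simp: module_axioms amult_add_left amult_smult_left amult_assoc)

text \<open>Brauer's lemma: a minimal left ideal \<open>L\<close> satisfies \<open>L u = L\<close> for some \<open>u \<in> L\<close>, and the
  solution of \<open>e u = u\<close> in \<open>L\<close> is idempotent because right multiplication by \<open>u\<close> is injective
  on \<open>L\<close>.\<close>

lemma division_corner_exists:
  assumes fd: "fin_dim" and prime: "prime_algebra A" and nz: "carrier A \<noteq> {\<zero>\<^bsub>A\<^esub>}"
  obtains e where "e \<in> carrier A" "e \<noteq> \<zero>\<^bsub>A\<^esub>" "e \<cdot> e = e"
    "\<And>x. \<lbrakk>x \<in> carrier A; e \<cdot> x = x; x \<cdot> e = x; x \<noteq> \<zero>\<^bsub>A\<^esub>\<rbrakk> \<Longrightarrow>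
       \<exists>y \<in> carrier A. e \<cdot> y = y \<and> y \<cdot> e = y \<and> y \<cdot> x = e \<and> x \<cdot> y = e"
proof -
  let ?\<I> = "{L. left_ideal L \<and> L \<noteq> {\<zero>\<^bsub>A\<^esub>}}"
  have "submodule F L A" if "L \<in> ?\<I>" for L
    using that by (simp add: left_ideal_def)
  then obtain L where "L \<in> ?\<I>" "\<forall>K \<in> ?\<I>. K \<subseteq> L \<longrightarrow> K = L"
    using minimal_submodule_exists[OF fd, of ?\<I> "carrier A"] nz left_ideal_carrier by blast
  then have L: "left_ideal L" "L \<noteq> {\<zero>\<^bsub>A\<^esub>}"
    and min: "\<And>K. left_ideal K \<Longrightarrow> K \<noteq> {\<zero>\<^bsub>A\<^esub>} \<Longrightarrow> K \<subseteq> L \<Longrightarrow> K = L"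
    by simp_all
  note LA = left_idealD[OF L(1)]
  obtain l where l: "l \<in> L" "l \<noteq> \<zero>\<^bsub>A\<^esub>"
    using L LA(2) by blast
  obtain a where a: "a \<in> carrier A" "l \<cdot> a \<cdot> l \<noteq> \<zero>\<^bsub>A\<^esub>"
    using primeE[OF prime] l LA(1) by metis
  \<comment> \<open>The right factor \<open>l\<close> puts \<open>u\<close> into \<open>L\<close>,
    and the choice of \<open>a\<close> by primeness, applied to the pair \<open>l\<close>,
    \<open>l\<close>, makes \<open>L u\<close> nonzero.\<close>
  define u where "u = a \<cdot> l"
  have u: "u \<in> L" "u \<in> carrier A" "l \<cdot> u \<noteq> \<zero>\<^bsub>A\<^esub>"
    using a l LA by (auto simp: u_def amult_assoc)
  have Lu: "(\<lambda>x. x \<cdot> u) ` L = L"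
    by (rule min[OF left_ideal_image_right_mult]) (use L u LA l in auto)
  \<comment> \<open>The annihilator of \<open>u\<close> in \<open>L\<close> is a left ideal that
    misses \<open>l\<close>, so minimality leaves only zero.\<close>
  have ann: "{x \<in> L. x \<cdot> u = \<zero>\<^bsub>A\<^esub>} = {\<zero>\<^bsub>A\<^esub>}"
    using min[OF left_ideal_annihilator[OF L(1) u(2)]] l u by blast
  obtain e where e: "e \<in> L" "e \<cdot> u = u"
    using Lu u by (metis imageE)
  have eA: "e \<in> carrier A"
    using e LA by blast
  have "(e \<cdot> e \<ominus>\<^bsub>A\<^esub> e) \<cdot> u = \<zero>\<^bsub>A\<^esub>"
    using eA u e by (simp add: amult_diff_left amult_assoc diff_eq_zero_iff)
  moreover have "e \<cdot> e \<ominus>\<^bsub>A\<^esub> e \<in> L"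
    using e eA LA by (intro left_ideal_diff[OF L(1)]) auto
  ultimately have "e \<cdot> e \<ominus>\<^bsub>A\<^esub> e = \<zero>\<^bsub>A\<^esub>"
    using ann by blast
  then have ee: "e \<cdot> e = e"
    using eA by (simp add: diff_eq_zero_iff)
  have e0: "e \<noteq> \<zero>\<^bsub>A\<^esub>"
    using e u l LA by (metis amult_zero_left amult_zero_right)
  have left: "\<exists>y \<in> carrier A. e \<cdot> y = y \<and> y \<cdot> e = y \<and> y \<cdot> x = e"
    if x: "x \<in> carrier A" "e \<cdot> x = x" "x \<cdot> e = x" "x \<noteq> \<zero>\<^bsub>A\<^esub>" for x
  proof -
    have xL: "x \<in> L"
      using LA(5)[OF x(1) e(1)] x by simp
    \<comment> \<open>The left ideal \<open>A x\<close> lies in \<open>L\<close> because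
      \<open>x\<close> does, and it contains \<open>e x = x\<close>, which is nonzero. Hence it is
      all of \<open>L\<close> and contains \<open>e\<close>.\<close>
    have "(\<lambda>y. y \<cdot> x) ` carrier A = L"
    proof (rule min[OF left_ideal_image_right_mult[OF left_ideal_carrier x(1)]])
      show "(\<lambda>y. y \<cdot> x) ` carrier A \<noteq> {\<zero>\<^bsub>A\<^esub>}"
        using x eA by (metis image_eqI singletonD)
    qed (use xL LA in auto)
    then obtain y where y: "y \<in> carrier A" "y \<cdot> x = e"
      using e by (metis imageE)
    \<comment> \<open>The solution \<open>y\<close> need not lie in the corner. Compressing it to
      \<open>e y e\<close> keeps the product, since \<open>e x = x\<close> and
      \<open>e e = e\<close>.\<close>
    have "e \<cdot> y \<cdot> e \<cdot> x = e"
      using y x eA ee by (simp add: amult_assoc)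
    moreover have "e \<cdot> (e \<cdot> y \<cdot> e) = e \<cdot> y \<cdot> e" "e \<cdot> y \<cdot> e \<cdot> e = e \<cdot> y \<cdot> e"
      using y eA ee by (simp_all add: amult_assoc) (simp_all flip: amult_assoc add: ee)
    ultimately show ?thesis
      using y eA by (intro bexI[of _ "e \<cdot> y \<cdot> e"]) auto
  qed
  have "\<exists>y \<in> carrier A. e \<cdot> y = y \<and> y \<cdot> e = y \<and> y \<cdot> x = e \<and> x \<cdot> y = e"
    if x: "x \<in> carrier A" "e \<cdot> x = x" "x \<cdot> e = x" "x \<noteq> \<zero>\<^bsub>A\<^esub>" for x
  proof -
    obtain y where y: "y \<in> carrier A" "e \<cdot> y = y" "y \<cdot> e = y" "y \<cdot> x = e"
      using left[OF x] by blast
    then have "y \<noteq> \<zero>\<^bsub>A\<^esub>"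
      using e0 x by auto
    then obtain z where z: "z \<in> carrier A" "z \<cdot> e = z" "z \<cdot> y = e"
      using left[of y] y by blast
    \<comment> \<open>A left inverse \<open>z\<close> of the left inverse \<open>y\<close> must be
      \<open>x\<close> itself, which makes \<open>y\<close> a two-sided inverse.\<close>
    have "z = z \<cdot> (y \<cdot> x)"
      using y z by simp
    also have "\<dots> = z \<cdot> y \<cdot> x"
      by (rule amult_assoc[symmetric, OF z(1) y(1) x(1)])
    also have "\<dots> = x"
      using z x by simp
    finally show ?thesis
      using y z by auto
  qed
  then show thesis
    using that eA e0 ee by blast
qed

section \<open>Corner algebras\<close>

text \<open>For an idempotent \<open>e\<close> this is \<open>eAe\<close>: the two fixed-point
  equations characterize its elements and at the same time make \<open>e\<close> a unity. The
  elements keep the type of those of \<open>A\<close>.\<close>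

definition corner :: "'c \<Rightarrow> ('a, 'c) module" where
  "corner e = \<lparr>carrier = {x \<in> carrier A. e \<cdot> x = x \<and> x \<cdot> e = x}, mult = (\<cdot>), one = e,
     zero = \<zero>\<^bsub>A\<^esub>, add = add A, smult = smult A\<rparr>"

lemma corner_simps [simp]:
  "x \<in> carrier (corner e) \<longleftrightarrow> x \<in> carrier A \<and> e \<cdot> x = x \<and> x \<cdot> e = x"
  "mult (corner e) = (\<cdot>)" "one (corner e) = e" "zero (corner e) = \<zero>\<^bsub>A\<^esub>"
  "add (corner e) = add A" "smult (corner e) = smult A"
  by (simp_all add: corner_def)

lemma vectorspace_corner:
  assumes "e \<in> carrier A"
  shows "vectorspace F (corner e)"
proof (rule vs_criteria)
  show "field F"
    by (rule field_axioms)
  show "\<forall>v \<in> carrier (corner e). \<exists>w \<in> carrier (corner e). v \<oplus>\<^bsub>corner e\<^esub> w = \<zero>\<^bsub>corner e\<^esub>"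
    using assms by (auto simp: amult_neg_left amult_neg_right M.r_neg intro!: bexI[of _ "\<ominus>\<^bsub>A\<^esub> _"])
qed (use assms in \<open>auto simp: amult_add_left amult_add_right amult_smult_left amult_smult_right
       M.a_ac smult_assoc1 smult_l_distr smult_r_distr\<close>)

lemma assoc_algebra_corner:
  assumes "e \<in> carrier A"
  shows "assoc_algebra F (corner e)"
  unfolding assoc_algebra_def assoc_algebra_axioms_def
proof (intro conjI allI impI)
  show "vectorspace F (corner e)"
    using assms by (rule vectorspace_corner)
next
  fix x y
  assume xy: "x \<in> carrier (corner e)" "y \<in> carrier (corner e)"
  then have "e \<cdot> (x \<cdot> y) = x \<cdot> y"
    using assms by (simp flip: amult_assoc)
  with xy show "x \<otimes>\<^bsub>corner e\<^esub> y \<in> carrier (corner e)"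
    using assms by (simp add: amult_assoc)
qed (auto simp: amult_assoc amult_add_left amult_add_right amult_smult_left amult_smult_right)

lemma ring_corner:
  assumes "e \<in> carrier A" "e \<cdot> e = e"
  shows "ring (corner e)"
proof (rule ringI)
  interpret C: assoc_algebra F "corner e"
    using assms(1) by (rule assoc_algebra_corner)
  show "abelian_group (corner e)"
    by (rule C.M.abelian_group_axioms)
  show "monoid (corner e)"
    using assms C.amult_closed C.amult_assoc by (intro monoidI) auto
  show "(x \<oplus>\<^bsub>corner e\<^esub> y) \<otimes>\<^bsub>corner e\<^esub> z = x \<otimes>\<^bsub>corner e\<^esub> z \<oplus>\<^bsub>corner e\<^esub> y \<otimes>\<^bsub>corner e\<^esub> z"
    if "x \<in> carrier (corner e)" "y \<in> carrier (corner e)" "z \<in> carrier (corner e)" for x y z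
    using that by (rule C.amult_add_left)
  show "z \<otimes>\<^bsub>corner e\<^esub> (x \<oplus>\<^bsub>corner e\<^esub> y) = z \<otimes>\<^bsub>corner e\<^esub> x \<oplus>\<^bsub>corner e\<^esub> z \<otimes>\<^bsub>corner e\<^esub> y"
    if "x \<in> carrier (corner e)" "y \<in> carrier (corner e)" "z \<in> carrier (corner e)" for x y z
    using that(3,1,2) by (rule C.amult_add_right)
qed

text \<open>Matrix products over the corner are sums formed in \<open>corner e\<close>, whereas the
  computations with dual systems take place in \<open>A\<close>; this reconciles the two.\<close>

lemma finsum_corner:
  assumes e: "e \<in> carrier A" and "finite I" "g \<in> I \<rightarrow> carrier (corner e)"
  shows "(\<Oplus>\<^bsub>corner e\<^esub>i\<in>I. g i) = (\<Oplus>\<^bsub>A\<^esub>i\<in>I. g i)"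
proof -
  interpret C: assoc_algebra F "corner e"
    using e by (rule assoc_algebra_corner)
  show ?thesis
    using assms(2,3)
  proof (induction I rule: finite_induct)
    case empty
    then show ?case
      by simp
  next
    case (insert i I)
    then have "g \<in> I \<rightarrow> carrier (corner e)" "g \<in> I \<rightarrow> carrier A" "g i \<in> carrier (corner e)" "g i \<in> carrier A"
      by (auto simp: Pi_def)
    then show ?case
      using insert by (simp add: C.M.finsum_insert M.finsum_insert del: corner_simps(1))
  qed
qed

section \<open>Dual systems\<close>

text \<open>For an idempotent \<open>e\<close> the equations place \<open>u i\<close> in
  \<open>eA\<close> and \<open>v i\<close> in \<open>Ae\<close>. Only values below \<open>n\<close>
  count, so a system is lengthened by a function update at \<open>n\<close>.\<close>

definition dual_system :: "'c \<Rightarrow> nat \<Rightarrow> (nat \<Rightarrow> 'c) \<Rightarrow> (nat \<Rightarrow> 'c) \<Rightarrow> bool" where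
  "dual_system e n u v \<longleftrightarrow>
     (\<forall>i<n. u i \<in> carrier A \<and> e \<cdot> u i = u i \<and> v i \<in> carrier A \<and> v i \<cdot> e = v i) \<and>
     (\<forall>i<n. \<forall>j<n. u i \<cdot> v j = (if i = j then e else \<zero>\<^bsub>A\<^esub>))"

lemma dual_systemD:
  assumes "dual_system e n u v" "i < n"
  shows "u i \<in> carrier A" "e \<cdot> u i = u i" "v i \<in> carrier A" "v i \<cdot> e = v i"
    "j < n \<Longrightarrow> u i \<cdot> v j = (if i = j then e else \<zero>\<^bsub>A\<^esub>)"
  using assms by (auto simp: dual_system_def)

lemma smult_eq_zeroD:
  assumes "c \<in> carrier F" "x \<in> carrier A" "x \<noteq> \<zero>\<^bsub>A\<^esub>" "c \<odot>\<^bsub>A\<^esub> x = \<zero>\<^bsub>A\<^esub>"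
  shows "c = \<zero>\<^bsub>F\<^esub>"
proof (rule ccontr)
  assume "c \<noteq> \<zero>\<^bsub>F\<^esub>"
  then obtain d where d: "d \<in> carrier F" "d \<otimes>\<^bsub>F\<^esub> c = \<one>\<^bsub>F\<^esub>"
    using assms(1) R.Units_l_inv_ex field_Units by auto
  then have "x = d \<odot>\<^bsub>A\<^esub> (c \<odot>\<^bsub>A\<^esub> x)"
    using assms(1,2) by (simp flip: smult_assoc1)
  then show False
    using assms d by simp
qed

text \<open>Left multiplication by \<open>u j\<close> turns a linear combination of the
  \<open>v i\<close> into the coefficient of \<open>v j\<close> times \<open>e\<close>. As
  \<open>e\<close> is nonzero, the \<open>v i\<close> are independent.\<close>

lemma dual_system_le_dim:
  assumes fd: "fin_dim" and e: "e \<in> carrier A" "e \<noteq> \<zero>\<^bsub>A\<^esub>" and uv: "dual_system e n u v"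
  shows "n \<le> dim"
proof -
  note D = dual_systemD[OF uv]
  let ?V = "v ` {..<n}"
  \<comment> \<open>Independence concerns the set of values; injectivity ensures that this set has
    \<open>n\<close> elements.\<close>
  have inj: "inj_on v {..<n}"
  proof (rule inj_onI)
    fix i j
    assume ij: "i \<in> {..<n}" "j \<in> {..<n}" "v i = v j"
    then have "u i \<cdot> v j = e"
      using D(5)[of i i] by simp
    then show "i = j"
      using D(5)[of i j] ij e by (auto split: if_splits)
  qed
  have VA: "?V \<subseteq> carrier A"
    using D by auto
  have "lin_indpt ?V"
  proof (rule finite_lin_indpt2)
    fix a
    assume a: "a \<in> ?V \<rightarrow> carrier F" and 0: "lincomb a ?V = \<zero>\<^bsub>A\<^esub>"
    have aF: "a w \<in> carrier F" if "w \<in> ?V" for w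
      using a that by blast
    show "\<forall>w \<in> ?V. a w = \<zero>\<^bsub>F\<^esub>"
    proof
      fix w
      assume w: "w \<in> ?V"
      then obtain j where j: "j < n" "w = v j"
        by auto
      have "\<zero>\<^bsub>A\<^esub> = u j \<cdot> lincomb a ?V"
        using D(1)[OF j(1)] 0 by simp
      also have "\<dots> = (\<Oplus>\<^bsub>A\<^esub>x\<in>?V. u j \<cdot> (a x \<odot>\<^bsub>A\<^esub> x))"
        unfolding lincomb_def using D(1)[OF j(1)] a VA by (intro finsum_amult_left) auto
      also have "\<dots> = (\<Oplus>\<^bsub>A\<^esub>x\<in>?V. if w = x then a x \<odot>\<^bsub>A\<^esub> e else \<zero>\<^bsub>A\<^esub>)"
      proof (rule M.finsum_cong')
        fix x
        assume "x \<in> ?V"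
        then obtain i where i: "i < n" "x = v i"
          by auto
        then have "a x \<in> carrier F" "w = x \<longleftrightarrow> j = i"
          using a j inj by (auto simp: inj_on_eq_iff)
        then show "u j \<cdot> (a x \<odot>\<^bsub>A\<^esub> x) = (if w = x then a x \<odot>\<^bsub>A\<^esub> e else \<zero>\<^bsub>A\<^esub>)"
          using D[OF i(1)] D(1,5)[OF j(1)] i by (simp add: amult_smult_right)
      qed (use aF e in auto)
      also have "\<dots> = a w \<odot>\<^bsub>A\<^esub> e"
        using w aF e(1) by (intro M.finsum_singleton) auto
      finally show "a w = \<zero>\<^bsub>F\<^esub>"
        by (rule smult_eq_zeroD[OF aF[OF w] e sym])
    qed
  qed (use VA in auto)
  then have "card ?V \<le> dim"
    using li_le_dim(2)[OF fd VA] by simp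
  then show ?thesis
    using card_image[OF inj] by simp
qed

context
  fixes e n u v
  assumes uv: "dual_system e n u v" and e: "e \<in> carrier A"
begin

private lemmas D = dual_systemD[OF uv]

text \<open>Left multiplication by \<open>f\<close> projects \<open>Ae\<close> onto the sum of the
  \<open>v k \<cdot> eAe\<close>, and its kernel there is the common annihilator of the
  \<open>u k\<close>.\<close>

private abbreviation "f \<equiv> \<Oplus>\<^bsub>A\<^esub>k\<in>{..<n}. v k \<cdot> u k"

lemma dual_sum_closed: "f \<in> carrier A"
  by (rule M.finsum_closed) (auto simp: D)

lemma dual_sum_amult: "w \<in> carrier A \<Longrightarrow> f \<cdot> w = (\<Oplus>\<^bsub>A\<^esub>k\<in>{..<n}. v k \<cdot> (u k \<cdot> w))"
  by (subst finsum_amult_right) (auto simp: D amult_assoc intro!: M.finsum_cong')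

lemma amult_dual_sum: "w \<in> carrier A \<Longrightarrow> w \<cdot> f = (\<Oplus>\<^bsub>A\<^esub>k\<in>{..<n}. w \<cdot> v k \<cdot> u k)"
  by (subst finsum_amult_left) (auto simp: D amult_assoc intro!: M.finsum_cong')

lemma dual_sum_amult_member:
  assumes j: "j < n"
  shows "f \<cdot> v j = v j"
proof -
  have "f \<cdot> v j = (\<Oplus>\<^bsub>A\<^esub>k\<in>{..<n}. if j = k then v k else \<zero>\<^bsub>A\<^esub>)"
    by (subst dual_sum_amult) (auto simp: D j intro!: M.finsum_cong')
  also have "\<dots> = v j"
    using j by (intro M.finsum_singleton) (auto simp: D)
  finally show ?thesis .
qed

lemma dual_sum_amult_zero:
  assumes "w \<in> carrier A" "\<And>i. i < n \<Longrightarrow> u i \<cdot> w = \<zero>\<^bsub>A\<^esub>"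
  shows "f \<cdot> w = \<zero>\<^bsub>A\<^esub>"
proof -
  have "f \<cdot> w = (\<Oplus>\<^bsub>A\<^esub>k\<in>{..<n}. \<zero>\<^bsub>A\<^esub>)"
    unfolding dual_sum_amult[OF assms(1)] using D assms by (intro M.finsum_cong') auto
  then show ?thesis
    by simp
qed

text \<open>The reason is \<open>u i \<cdot> f = u i\<close>. A nonzero difference of this kind,
  with \<open>w\<close> in \<open>Ae\<close>, is a candidate for a further vector
  \<open>v n\<close>.\<close>

lemma dual_system_annihilates_diff:
  assumes w: "w \<in> carrier A" and i: "i < n"
  shows "u i \<cdot> (w \<ominus>\<^bsub>A\<^esub> f \<cdot> w) = \<zero>\<^bsub>A\<^esub>"
proof -
  have "u i \<cdot> f = (\<Oplus>\<^bsub>A\<^esub>k\<in>{..<n}. if i = k then u k else \<zero>\<^bsub>A\<^esub>)"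
    by (subst amult_dual_sum) (auto simp: D i intro!: M.finsum_cong')
  also have "\<dots> = u i"
    using i by (intro M.finsum_singleton) (auto simp: D)
  finally have "u i \<cdot> f \<cdot> w = u i \<cdot> w"
    by simp
  then show ?thesis
    using w D(1)[OF i] dual_sum_closed by (simp add: amult_diff_right amult_assoc diff_eq_zero_iff)
qed

text \<open>A Gram-Schmidt step: \<open>w\<close> becomes the new \<open>v n\<close>, and primeness
  supplies an element of \<open>eA\<close> whose product with \<open>w\<close> is nonzero, which is
  then made orthogonal to the old \<open>v j\<close> and normalized.\<close>

lemma dual_system_extend:
  assumes prime: "prime_algebra A" and ee: "e \<noteq> \<zero>\<^bsub>A\<^esub>" "e \<cdot> e = e"
    and inv: "\<And>x. \<lbrakk>x \<in> carrier A; e \<cdot> x = x; x \<cdot> e = x; x \<noteq> \<zero>\<^bsub>A\<^esub>\<rbrakk> \<Longrightarrow>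
       \<exists>y \<in> carrier A. e \<cdot> y = y \<and> y \<cdot> e = y \<and> y \<cdot> x = e \<and> x \<cdot> y = e"
    and w: "w \<in> carrier A" "w \<cdot> e = w" "w \<noteq> \<zero>\<^bsub>A\<^esub>" and uw: "\<And>i. i < n \<Longrightarrow> u i \<cdot> w = \<zero>\<^bsub>A\<^esub>"
  shows "\<exists>u' v'. dual_system e (Suc n) u' v'"
proof -
  note f = dual_sum_closed
  obtain x where x: "x \<in> carrier A" "e \<cdot> x \<cdot> w \<noteq> \<zero>\<^bsub>A\<^esub>"
    using primeE[OF prime e w(1) ee(1) w(3)] .
  \<comment> \<open>The correction term gives \<open>y \<cdot> v j = 0\<close> because
    \<open>f\<close> fixes \<open>v j\<close>, and leaves the product with \<open>w\<close>
    unchanged because \<open>f \<cdot> w = 0\<close>.\<close>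
  define y where "y = e \<cdot> x \<ominus>\<^bsub>A\<^esub> e \<cdot> x \<cdot> f"
  have y: "y \<in> carrier A"
    using e x f by (simp add: y_def)
  have "e \<cdot> (e \<cdot> z) = e \<cdot> z" if "z \<in> carrier A" for z
    using amult_assoc[OF e e that] ee by simp
  then have ey: "e \<cdot> y = y"
    using e x f by (simp add: y_def amult_diff_right amult_assoc)
  have yv: "y \<cdot> v j = \<zero>\<^bsub>A\<^esub>" if "j < n" for j
    using that e x f D(3)[OF that] dual_sum_amult_member[OF that]
    by (simp add: y_def amult_diff_left amult_assoc diff_eq_zero_iff)
  have yw: "y \<cdot> w = e \<cdot> x \<cdot> w"
    using e x f w dual_sum_amult_zero[OF w(1) uw]
    by (simp add: y_def a_minus_def amult_add_left amult_neg_left amult_assoc)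
  have ywe: "e \<cdot> (y \<cdot> w) = y \<cdot> w" "y \<cdot> w \<cdot> e = y \<cdot> w"
    using amult_assoc[OF e y w(1)] amult_assoc[OF y w(1) e] ey w by simp_all
  have "y \<cdot> w \<noteq> \<zero>\<^bsub>A\<^esub>"
    using x yw by simp
  \<comment> \<open>Since \<open>y \<cdot> w\<close> is a nonzero element of the corner, it has an
    inverse \<open>d\<close> there, and \<open>d \<cdot> y\<close> is the normalized new
    \<open>u n\<close>.\<close>
  then obtain d where d: "d \<in> carrier A" "e \<cdot> d = d" "d \<cdot> (y \<cdot> w) = e"
    using inv[OF amult_closed[OF y w(1)] ywe] by blast
  have "e \<cdot> (d \<cdot> y) = d \<cdot> y"
    using e d y by (simp flip: amult_assoc)
  moreover have "d \<cdot> y \<cdot> v j = \<zero>\<^bsub>A\<^esub>" if "j < n" for j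
    using d y yv[OF that] D(3)[OF that] by (simp add: amult_assoc)
  moreover have "d \<cdot> y \<cdot> w = e"
    using d y w by (simp add: amult_assoc)
  ultimately have "dual_system e (Suc n) (u(n := d \<cdot> y)) (v(n := w))"
    unfolding dual_system_def using D uw w d y by (auto simp: less_Suc_eq)
  then show ?thesis
    by blast
qed

end

text \<open>In a system of greatest length \<open>f\<close> fixes \<open>Ae\<close>, as otherwise a
  difference \<open>w - f w\<close> would extend the system. Primeness then carries this from
  \<open>Ae\<close> to all of \<open>A\<close>, on both sides.\<close>

lemma complete_dual_system_exists:
  assumes fd: "fin_dim" and prime: "prime_algebra A" and e: "e \<in> carrier A" "e \<noteq> \<zero>\<^bsub>A\<^esub>" "e \<cdot> e = e"
    and inv: "\<And>x. \<lbrakk>x \<in> carrier A; e \<cdot> x = x; x \<cdot> e = x; x \<noteq> \<zero>\<^bsub>A\<^esub>\<rbrakk> \<Longrightarrow>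
       \<exists>y \<in> carrier A. e \<cdot> y = y \<and> y \<cdot> e = y \<and> y \<cdot> x = e \<and> x \<cdot> y = e"
  obtains n u v where "dual_system e n u v"
    "\<And>x. x \<in> carrier A \<Longrightarrow> (\<Oplus>\<^bsub>A\<^esub>k\<in>{..<n}. v k \<cdot> u k) \<cdot> x = x"
    "\<And>x. x \<in> carrier A \<Longrightarrow> x \<cdot> (\<Oplus>\<^bsub>A\<^esub>k\<in>{..<n}. v k \<cdot> u k) = x"
proof -
  let ?P = "\<lambda>n. \<exists>u v. dual_system e n u v"
  have P0: "?P 0"
    by (simp add: dual_system_def)
  have bound: "\<forall>n. ?P n \<longrightarrow> n \<le> dim"
    using dual_system_le_dim[OF fd e(1,2)] by blast
  \<comment> \<open>The greatest length exists because the empty system qualifies and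
    \<open>dim\<close> bounds all lengths.\<close>
  define n where "n = (GREATEST n. ?P n)"
  have "?P n"
    unfolding n_def by (rule GreatestI_nat[of ?P 0 dim]) (use P0 bound in auto)
  then obtain u v where uv: "dual_system e n u v"
    by blast
  have max: "\<not> ?P (Suc n)"
    using Greatest_le_nat[of ?P "Suc n" dim] bound n_def by auto
  define f where "f = (\<Oplus>\<^bsub>A\<^esub>k\<in>{..<n}. v k \<cdot> u k)"
  have f: "f \<in> carrier A"
    unfolding f_def by (rule dual_sum_closed[OF uv e(1)])
  have fw: "f \<cdot> w = w" if w: "w \<in> carrier A" "w \<cdot> e = w" for w
  proof (rule ccontr)
    assume "f \<cdot> w \<noteq> w"
    then have "w \<ominus>\<^bsub>A\<^esub> f \<cdot> w \<noteq> \<zero>\<^bsub>A\<^esub>"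
      using f w by (simp add: diff_eq_zero_iff)
    moreover have "(w \<ominus>\<^bsub>A\<^esub> f \<cdot> w) \<cdot> e = w \<ominus>\<^bsub>A\<^esub> f \<cdot> w"
      using f w e by (simp add: amult_diff_left amult_assoc)
    moreover have "u i \<cdot> (w \<ominus>\<^bsub>A\<^esub> f \<cdot> w) = \<zero>\<^bsub>A\<^esub>" if "i < n" for i
      unfolding f_def using dual_system_annihilates_diff[OF uv e(1) w(1) that] .
    moreover have "w \<ominus>\<^bsub>A\<^esub> f \<cdot> w \<in> carrier A"
      using f w by simp
    ultimately show False
      using dual_system_extend[OF uv e(1) prime e(2,3) inv] max by blast
  qed
  \<comment> \<open>The left module \<open>Ae\<close> is faithful: if \<open>a - b\<close> kills it,
    primeness and \<open>e \<noteq> 0\<close> give \<open>a = b\<close>.\<close>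
  have faithful: "a = b"
    if ab: "a \<in> carrier A" "b \<in> carrier A"
      "\<And>y. y \<in> carrier A \<Longrightarrow> a \<cdot> (y \<cdot> e) = b \<cdot> (y \<cdot> e)" for a b
  proof (rule ccontr)
    assume "a \<noteq> b"
    then have "a \<ominus>\<^bsub>A\<^esub> b \<noteq> \<zero>\<^bsub>A\<^esub>" "a \<ominus>\<^bsub>A\<^esub> b \<in> carrier A"
      using ab by (simp_all add: diff_eq_zero_iff)
    then obtain y where y: "y \<in> carrier A" "(a \<ominus>\<^bsub>A\<^esub> b) \<cdot> y \<cdot> e \<noteq> \<zero>\<^bsub>A\<^esub>"
      using primeE[OF prime _ e(1) _ e(2)] by metis
    then show False
      using ab(3)[OF y(1)] ab e by (simp add: amult_diff_left amult_assoc diff_eq_zero_iff)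
  qed
  have fye: "f \<cdot> (y \<cdot> e) = y \<cdot> e" if "y \<in> carrier A" for y
    using that e by (intro fw) (simp_all add: amult_assoc)
  \<comment> \<open>Both identities are tested on \<open>Ae\<close>. The first uses that
    \<open>f\<close> fixes \<open>(x y) e\<close>, the second that it fixes
    \<open>y e\<close>.\<close>
  show thesis
  proof (rule that[OF uv])
    fix x
    assume x: "x \<in> carrier A"
    show "(\<Oplus>\<^bsub>A\<^esub>k\<in>{..<n}. v k \<cdot> u k) \<cdot> x = x"
      unfolding f_def[symmetric]
    proof (rule faithful)
      fix y
      assume y: "y \<in> carrier A"
      show "f \<cdot> x \<cdot> (y \<cdot> e) = x \<cdot> (y \<cdot> e)"
        using fye[of "x \<cdot> y"] f x y e by (simp add: amult_assoc)
    qed (use f x in auto)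
    show "x \<cdot> (\<Oplus>\<^bsub>A\<^esub>k\<in>{..<n}. v k \<cdot> u k) = x"
      unfolding f_def[symmetric]
    proof (rule faithful)
      fix y
      assume y: "y \<in> carrier A"
      show "x \<cdot> f \<cdot> (y \<cdot> e) = x \<cdot> (y \<cdot> e)"
        using fye[OF y] f x y e by (simp add: amult_assoc)
    qed (use f x in auto)
  qed
qed

end

section \<open>Isomorphism with matrices over the corner\<close>

lemma matrix_algebra_simps:
  "carrier (matrix_algebra n D) = ({..<n} \<times> {..<n}) \<rightarrow>\<^sub>E carrier D"
  "\<zero>\<^bsub>matrix_algebra n D\<^esub> = (\<lambda>p \<in> {..<n} \<times> {..<n}. \<zero>\<^bsub>D\<^esub>)"
  "M \<otimes>\<^bsub>matrix_algebra n D\<^esub> N =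
     (\<lambda>(i, j) \<in> {..<n} \<times> {..<n}. \<Oplus>\<^bsub>D\<^esub>k\<in>{..<n}. M (i, k) \<otimes>\<^bsub>D\<^esub> N (k, j))"
  "M \<oplus>\<^bsub>matrix_algebra n D\<^esub> N = (\<lambda>p \<in> {..<n} \<times> {..<n}. M p \<oplus>\<^bsub>D\<^esub> N p)"
  "c \<odot>\<^bsub>matrix_algebra n D\<^esub> M = (\<lambda>p \<in> {..<n} \<times> {..<n}. c \<odot>\<^bsub>D\<^esub> M p)"
  by (simp_all add: matrix_algebra_def)

context assoc_algebra
begin

text \<open>Inserting the unity, written as the sum of the \<open>v k \<cdot> u k\<close>, makes
  \<open>\<phi>\<close> multiplicative and gives \<open>\<psi> (\<phi> a) = a\<close>; the duality
  relations give \<open>\<phi> (\<psi> M) = M\<close>.\<close>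

lemma matrix_algebra_of_dual_system:
  assumes uv: "dual_system e n u v" and e: "e \<in> carrier A"
    and f_left: "\<And>x. x \<in> carrier A \<Longrightarrow> (\<Oplus>\<^bsub>A\<^esub>k\<in>{..<n}. v k \<cdot> u k) \<cdot> x = x"
    and f_right: "\<And>x. x \<in> carrier A \<Longrightarrow> x \<cdot> (\<Oplus>\<^bsub>A\<^esub>k\<in>{..<n}. v k \<cdot> u k) = x"
  shows "algebra_isomorphic F A (matrix_algebra n (corner e))"
proof -
  note D = dual_systemD[OF uv]
  define \<phi> where "\<phi> a = (\<lambda>(i, j) \<in> {..<n} \<times> {..<n}. u i \<cdot> a \<cdot> v j)" for a
  define \<psi> where "\<psi> M = (\<Oplus>\<^bsub>A\<^esub>i\<in>{..<n}. \<Oplus>\<^bsub>A\<^esub>j\<in>{..<n}. v i \<cdot> M (i, j) \<cdot> u j)" for M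
  have corner: "u i \<cdot> a \<cdot> v j \<in> carrier (corner e)"
    if "a \<in> carrier A" "i < n" "j < n" for a i j
  proof -
    have "e \<cdot> (u i \<cdot> (a \<cdot> v j)) = e \<cdot> u i \<cdot> (a \<cdot> v j)"
      using that D e by (intro amult_assoc[symmetric]) auto
    also have "\<dots> = u i \<cdot> (a \<cdot> v j)"
      using that D by simp
    finally show ?thesis
      using that D e by (simp add: amult_assoc)
  qed
  have \<phi>_closed: "\<phi> a \<in> carrier (matrix_algebra n (corner e))" if "a \<in> carrier A" for a
    using corner[OF that] by (auto simp: \<phi>_def matrix_algebra_simps simp del: corner_simps(1))
  \<comment> \<open>The unity is inserted between \<open>a\<close> and \<open>b\<close>, which later
    produces the sum over the inner index of a matrix product.\<close>
  have sandwich: "a \<cdot> b = (\<Oplus>\<^bsub>A\<^esub>k\<in>{..<n}. a \<cdot> v k \<cdot> (u k \<cdot> b))"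
    if ab: "a \<in> carrier A" "b \<in> carrier A" for a b
  proof -
    have "a \<cdot> b = a \<cdot> ((\<Oplus>\<^bsub>A\<^esub>k\<in>{..<n}. v k \<cdot> u k) \<cdot> b)"
      using ab f_left by simp
    also have "\<dots> = a \<cdot> (\<Oplus>\<^bsub>A\<^esub>k\<in>{..<n}. v k \<cdot> (u k \<cdot> b))"
      using dual_sum_amult[OF uv e ab(2)] by simp
    also have "\<dots> = (\<Oplus>\<^bsub>A\<^esub>k\<in>{..<n}. a \<cdot> (v k \<cdot> (u k \<cdot> b)))"
      using D ab by (intro finsum_amult_left) auto
    also have "\<dots> = (\<Oplus>\<^bsub>A\<^esub>k\<in>{..<n}. a \<cdot> v k \<cdot> (u k \<cdot> b))"
      using D ab by (intro M.finsum_cong') (auto simp: amult_assoc)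
    finally show ?thesis .
  qed
  have mult: "\<phi> (a \<cdot> b) = \<phi> a \<otimes>\<^bsub>matrix_algebra n (corner e)\<^esub> \<phi> b"
    if ab: "a \<in> carrier A" "b \<in> carrier A" for a b
  proof -
    have "u i \<cdot> (a \<cdot> b) \<cdot> v j = (\<Oplus>\<^bsub>corner e\<^esub>k\<in>{..<n}. \<phi> a (i, k) \<cdot> \<phi> b (k, j))"
      if ij: "i < n" "j < n" for i j
    proof -
      have "u i \<cdot> (a \<cdot> b) \<cdot> v j = (u i \<cdot> a) \<cdot> (b \<cdot> v j)"
        using ab ij D by (simp add: amult_assoc)
      also have "\<dots> = (\<Oplus>\<^bsub>A\<^esub>k\<in>{..<n}. u i \<cdot> a \<cdot> v k \<cdot> (u k \<cdot> (b \<cdot> v j)))"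
        using ab ij D by (intro sandwich) auto
      also have "\<dots> = (\<Oplus>\<^bsub>A\<^esub>k\<in>{..<n}. \<phi> a (i, k) \<cdot> \<phi> b (k, j))"
        using ab ij D by (intro M.finsum_cong') (auto simp: \<phi>_def amult_assoc)
      also have "\<dots> = (\<Oplus>\<^bsub>corner e\<^esub>k\<in>{..<n}. \<phi> a (i, k) \<cdot> \<phi> b (k, j))"
      proof (rule finsum_corner[symmetric, OF e])
        interpret C: assoc_algebra F "corner e"
          using e by (rule assoc_algebra_corner)
        show "(\<lambda>k. \<phi> a (i, k) \<cdot> \<phi> b (k, j)) \<in> {..<n} \<rightarrow> carrier (corner e)"
          using C.amult_closed[OF corner corner] ab ij by (auto simp: \<phi>_def simp del: corner_simps(1))
      qed simp
      finally show ?thesis .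
    qed
    then show ?thesis
      by (auto simp: matrix_algebra_simps \<phi>_def[of "a \<cdot> b"] intro!: restrict_ext)
  qed
  have hom: "\<phi> \<in> module_hom F A (matrix_algebra n (corner e))"
    unfolding module_hom_def using \<phi>_closed D
    by (auto simp: \<phi>_def matrix_algebra_simps amult_add_left amult_add_right amult_smult_left
        amult_smult_right intro!: restrict_ext)
  have \<psi>\<phi>: "\<psi> (\<phi> a) = a" if a: "a \<in> carrier A" for a
  proof -
    have "(\<Oplus>\<^bsub>A\<^esub>j\<in>{..<n}. v i \<cdot> \<phi> a (i, j) \<cdot> u j) = v i \<cdot> u i \<cdot> a" if i: "i < n" for i
    proof -
      have "(\<Oplus>\<^bsub>A\<^esub>j\<in>{..<n}. v i \<cdot> \<phi> a (i, j) \<cdot> u j) = (\<Oplus>\<^bsub>A\<^esub>j\<in>{..<n}. v i \<cdot> u i \<cdot> a \<cdot> v j \<cdot> u j)"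
        using D i a by (intro M.finsum_cong') (auto simp: \<phi>_def amult_assoc)
      also have "\<dots> = v i \<cdot> u i \<cdot> a \<cdot> (\<Oplus>\<^bsub>A\<^esub>k\<in>{..<n}. v k \<cdot> u k)"
        using D i a by (intro amult_dual_sum[OF uv e, symmetric]) auto
      also have "\<dots> = v i \<cdot> u i \<cdot> a"
        using D i a by (intro f_right) auto
      finally show ?thesis .
    qed
    then have "\<psi> (\<phi> a) = (\<Oplus>\<^bsub>A\<^esub>i\<in>{..<n}. v i \<cdot> u i \<cdot> a)"
      unfolding \<psi>_def using D a by (intro M.finsum_cong') auto
    also have "\<dots> = (\<Oplus>\<^bsub>A\<^esub>i\<in>{..<n}. v i \<cdot> u i) \<cdot> a"
      using D a by (intro finsum_amult_right[symmetric]) auto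
    finally show ?thesis
      using f_left a by simp
  qed
  have entry: "M (i, j) \<in> carrier A \<and> e \<cdot> M (i, j) = M (i, j) \<and> M (i, j) \<cdot> e = M (i, j)"
    if "M \<in> carrier (matrix_algebra n (corner e))" "i < n" "j < n" for M i j
    using that PiE_mem[of M _ _ "(i, j)"] by (auto simp: matrix_algebra_simps)
  have \<psi>_closed: "\<psi> M \<in> carrier A" if "M \<in> carrier (matrix_algebra n (corner e))" for M
    unfolding \<psi>_def using entry[OF that] D by (intro M.finsum_closed) (auto intro!: M.finsum_closed)
  have \<phi>\<psi>: "\<phi> (\<psi> M) = M" if M: "M \<in> carrier (matrix_algebra n (corner e))" for M
  proof -
    note E = entry[OF M]
    have inner: "(\<Oplus>\<^bsub>A\<^esub>j\<in>{..<n}. v i \<cdot> M (i, j) \<cdot> u j) \<in> carrier A" if "i < n" for i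
      using E D that by (intro M.finsum_closed) auto
    have "u k \<cdot> \<psi> M \<cdot> v l = M (k, l)" if kl: "k < n" "l < n" for k l
    proof -
      \<comment> \<open>Multiplying by \<open>u k\<close> on the left selects row \<open>k\<close>;
        multiplying by \<open>v l\<close> on the right afterwards selects column
        \<open>l\<close>.\<close>
      have row: "u k \<cdot> (\<Oplus>\<^bsub>A\<^esub>j\<in>{..<n}. v i \<cdot> M (i, j) \<cdot> u j)
          = (if k = i then \<Oplus>\<^bsub>A\<^esub>j\<in>{..<n}. M (i, j) \<cdot> u j else \<zero>\<^bsub>A\<^esub>)" if i: "i < n" for i
      proof -
        have "u k \<cdot> (\<Oplus>\<^bsub>A\<^esub>j\<in>{..<n}. v i \<cdot> M (i, j) \<cdot> u j)
            = (\<Oplus>\<^bsub>A\<^esub>j\<in>{..<n}. u k \<cdot> (v i \<cdot> M (i, j) \<cdot> u j))"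
          using E D kl i by (intro finsum_amult_left) auto
        also have "\<dots> = (\<Oplus>\<^bsub>A\<^esub>j\<in>{..<n}. if k = i then M (i, j) \<cdot> u j else \<zero>\<^bsub>A\<^esub>)"
        proof (rule M.finsum_cong')
          fix j
          assume j: "j \<in> {..<n}"
          have "u k \<cdot> (v i \<cdot> M (i, j) \<cdot> u j) = u k \<cdot> v i \<cdot> M (i, j) \<cdot> u j"
            using E D(1,3) kl i j by (simp add: amult_assoc)
          then show "u k \<cdot> (v i \<cdot> M (i, j) \<cdot> u j) = (if k = i then M (i, j) \<cdot> u j else \<zero>\<^bsub>A\<^esub>)"
            using E D kl i j by auto
        qed (use E D i in auto)
        finally show ?thesis
          by simp
      qed
      have "u k \<cdot> \<psi> M = (\<Oplus>\<^bsub>A\<^esub>i\<in>{..<n}. u k \<cdot> (\<Oplus>\<^bsub>A\<^esub>j\<in>{..<n}. v i \<cdot> M (i, j) \<cdot> u j))"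
        unfolding \<psi>_def using inner D kl by (intro finsum_amult_left) auto
      also have "\<dots> = (\<Oplus>\<^bsub>A\<^esub>i\<in>{..<n}. if k = i then \<Oplus>\<^bsub>A\<^esub>j\<in>{..<n}. M (i, j) \<cdot> u j else \<zero>\<^bsub>A\<^esub>)"
        using row E D by (intro M.finsum_cong') (auto intro!: M.finsum_closed)
      also have "\<dots> = (\<Oplus>\<^bsub>A\<^esub>j\<in>{..<n}. M (k, j) \<cdot> u j)"
        using kl E D by (intro M.finsum_singleton) (auto intro!: M.finsum_closed)
      finally have "u k \<cdot> \<psi> M \<cdot> v l = (\<Oplus>\<^bsub>A\<^esub>j\<in>{..<n}. M (k, j) \<cdot> u j) \<cdot> v l"
        by simp
      also have "\<dots> = (\<Oplus>\<^bsub>A\<^esub>j\<in>{..<n}. M (k, j) \<cdot> u j \<cdot> v l)"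
        using kl E D by (intro finsum_amult_right) auto
      also have "\<dots> = (\<Oplus>\<^bsub>A\<^esub>j\<in>{..<n}. if l = j then M (k, j) else \<zero>\<^bsub>A\<^esub>)"
        using kl E D by (intro M.finsum_cong') (auto simp: amult_assoc)
      also have "\<dots> = M (k, l)"
        using kl E by (intro M.finsum_singleton) auto
      finally show ?thesis .
    qed
    \<comment> \<open>Off the index square both sides are \<open>undefined\<close>, so agreement of
      the entries suffices.\<close>
    then show ?thesis
      using M by (auto simp: \<phi>_def matrix_algebra_simps PiE_iff extensional_def fun_eq_iff)
  qed
  have "bij_betw \<phi> (carrier A) (carrier (matrix_algebra n (corner e)))"
    by (rule bij_betw_byWitness[of _ \<psi>]) (use \<phi>\<psi> \<psi>\<phi> \<phi>_closed \<psi>_closed in auto)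
  then show ?thesis
    unfolding algebra_isomorphic_def using hom mult by blast
qed

lemma prime_imp_matrix_algebra:
  assumes fd: "fin_dim" and prime: "prime_algebra A" and nz: "carrier A \<noteq> {\<zero>\<^bsub>A\<^esub>}"
  shows "\<exists>n > 0. \<exists>D :: ('a, 'c) module. division_algebra F D \<and> algebra_isomorphic F A (matrix_algebra n D)"
proof -
  obtain e where e: "e \<in> carrier A" "e \<noteq> \<zero>\<^bsub>A\<^esub>" "e \<cdot> e = e"
    and inv: "\<And>x. \<lbrakk>x \<in> carrier A; e \<cdot> x = x; x \<cdot> e = x; x \<noteq> \<zero>\<^bsub>A\<^esub>\<rbrakk> \<Longrightarrow>
       \<exists>y \<in> carrier A. e \<cdot> y = y \<and> y \<cdot> e = y \<and> y \<cdot> x = e \<and> x \<cdot> y = e"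
    using division_corner_exists[OF assms] by blast
  obtain n u v where uv: "dual_system e n u v"
    and f: "\<And>x. x \<in> carrier A \<Longrightarrow> (\<Oplus>\<^bsub>A\<^esub>k\<in>{..<n}. v k \<cdot> u k) \<cdot> x = x"
      "\<And>x. x \<in> carrier A \<Longrightarrow> x \<cdot> (\<Oplus>\<^bsub>A\<^esub>k\<in>{..<n}. v k \<cdot> u k) = x"
    using complete_dual_system_exists[OF fd prime e inv] by blast
  \<comment> \<open>For \<open>n = 0\<close> the sum would be empty, hence zero, and could not fix
    the nonzero \<open>e\<close>.\<close>
  have "n \<noteq> 0"
    using f(1)[OF e(1)] e(1,2) by (intro notI) simp
  moreover have "a \<in> Units (corner e)" if "a \<in> carrier (corner e)" "a \<noteq> \<zero>\<^bsub>A\<^esub>" for a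
    using inv[of a] that by (force simp: Units_def)
  then have "division_algebra F (corner e)"
    unfolding division_algebra_def
    using assoc_algebra_corner[OF e(1)] ring_corner[OF e(1,3)] e(2)
    by (simp del: corner_simps(1))
  ultimately show ?thesis
    using matrix_algebra_of_dual_system[OF uv e(1) f] by blast
qed

end

section \<open>Primeness of matrix algebras over division algebras\<close>

text \<open>With a suitable matrix unit in the middle, one entry of the product is a nonzero entry
  of \<open>M\<close> times a nonzero entry of \<open>N\<close>, and a division algebra has no zero
  divisors.\<close>

lemma matrix_algebra_prime_witness:
  assumes D: "division_algebra F D"
    and M: "M \<in> carrier (matrix_algebra n D)" "M \<noteq> \<zero>\<^bsub>matrix_algebra n D\<^esub>"
    and N: "N \<in> carrier (matrix_algebra n D)" "N \<noteq> \<zero>\<^bsub>matrix_algebra n D\<^esub>"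
  obtains X where "X \<in> carrier (matrix_algebra n D)"
    "M \<otimes>\<^bsub>matrix_algebra n D\<^esub> X \<otimes>\<^bsub>matrix_algebra n D\<^esub> N \<noteq> \<zero>\<^bsub>matrix_algebra n D\<^esub>"
proof -
  interpret D: ring D
    using D by (simp add: division_algebra_def)
  have nonzero_entry: "\<exists>i<n. \<exists>j<n. P (i, j) \<noteq> \<zero>\<^bsub>D\<^esub>"
    if "P \<in> carrier (matrix_algebra n D)" "P \<noteq> \<zero>\<^bsub>matrix_algebra n D\<^esub>" for P
  proof (rule ccontr)
    assume "\<not> ?thesis"
    then have "P = \<zero>\<^bsub>matrix_algebra n D\<^esub>"
      using that(1) by (auto simp: matrix_algebra_simps PiE_iff extensional_def fun_eq_iff)
    with that(2) show False ..
  qed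
  have entry: "P (i, j) \<in> carrier D" if "P \<in> carrier (matrix_algebra n D)" "i < n" "j < n" for P i j
    using that PiE_mem[of P _ _ "(i, j)"] by (auto simp: matrix_algebra_simps)
  obtain i j where ij: "i < n" "j < n" "M (i, j) \<noteq> \<zero>\<^bsub>D\<^esub>"
    using nonzero_entry[OF M] by blast
  obtain k l where kl: "k < n" "l < n" "N (k, l) \<noteq> \<zero>\<^bsub>D\<^esub>"
    using nonzero_entry[OF N] by blast
  \<comment> \<open>The matrix unit at \<open>(j, k)\<close> links column \<open>j\<close> of
    \<open>M\<close> with row \<open>k\<close> of \<open>N\<close>, so that entry
    \<open>(i, l)\<close> of the triple product is \<open>M (i, j)\<close> times
    \<open>N (k, l)\<close>.\<close>
  define X where "X = (\<lambda>p \<in> {..<n} \<times> {..<n}. if p = (j, k) then \<one>\<^bsub>D\<^esub> else \<zero>\<^bsub>D\<^esub>)"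
  let ?MX = "M \<otimes>\<^bsub>matrix_algebra n D\<^esub> X"
  have MX: "?MX (i, q) = (if k = q then M (i, j) else \<zero>\<^bsub>D\<^esub>)" if q: "q < n" for q
  proof -
    have "?MX (i, q) = (\<Oplus>\<^bsub>D\<^esub>p\<in>{..<n}. M (i, p) \<otimes>\<^bsub>D\<^esub> X (p, q))"
      using ij q by (simp add: matrix_algebra_simps)
    also have "\<dots> = (\<Oplus>\<^bsub>D\<^esub>p\<in>{..<n}. if j = p then (if k = q then M (i, p) else \<zero>\<^bsub>D\<^esub>) else \<zero>\<^bsub>D\<^esub>)"
      using ij q entry[OF M(1)] by (intro D.finsum_cong') (auto simp: X_def)
    also have "\<dots> = (if k = q then M (i, j) else \<zero>\<^bsub>D\<^esub>)"
      using ij entry[OF M(1)] by (intro D.finsum_singleton) auto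
    finally show ?thesis .
  qed
  have "(?MX \<otimes>\<^bsub>matrix_algebra n D\<^esub> N) (i, l) = (\<Oplus>\<^bsub>D\<^esub>q\<in>{..<n}. ?MX (i, q) \<otimes>\<^bsub>D\<^esub> N (q, l))"
    using ij kl by (simp add: matrix_algebra_simps(3)[of _ _ ?MX])
  also have "\<dots> = (\<Oplus>\<^bsub>D\<^esub>q\<in>{..<n}. if k = q then M (i, j) \<otimes>\<^bsub>D\<^esub> N (q, l) else \<zero>\<^bsub>D\<^esub>)"
    using ij kl MX entry[OF M(1)] entry[OF N(1)] by (intro D.finsum_cong') auto
  also have "\<dots> = M (i, j) \<otimes>\<^bsub>D\<^esub> N (k, l)"
    using ij kl entry[OF M(1)] entry[OF N(1)] by (intro D.finsum_singleton) auto
  also have "\<dots> \<noteq> \<zero>\<^bsub>D\<^esub>"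
  proof
    have mem: "M (i, j) \<in> carrier D" "N (k, l) \<in> carrier D"
      using ij kl entry M N by auto
    then have "M (i, j) \<in> Units D"
      using D ij by (simp add: division_algebra_def)
    moreover assume "M (i, j) \<otimes>\<^bsub>D\<^esub> N (k, l) = \<zero>\<^bsub>D\<^esub>"
    ultimately have "N (k, l) = \<zero>\<^bsub>D\<^esub>"
      using mem D.Units_l_cancel[of "M (i, j)" "N (k, l)" "\<zero>\<^bsub>D\<^esub>"] by simp
    with kl show False
      by simp
  qed
  finally have "?MX \<otimes>\<^bsub>matrix_algebra n D\<^esub> N \<noteq> \<zero>\<^bsub>matrix_algebra n D\<^esub>"
    using ij kl by (auto simp: matrix_algebra_simps(2))
  moreover have "X \<in> carrier (matrix_algebra n D)"
    by (auto simp: X_def matrix_algebra_simps)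
  ultimately show thesis
    using that by blast
qed

text \<open>Injectivity keeps the images of nonzero \<open>a\<close> and \<open>b\<close> nonzero,
  and surjectivity pulls the middle factor \<open>X\<close> back to \<open>A\<close>.\<close>

lemma prime_algebra_of_matrix_algebra:
  assumes A: "assoc_algebra F A" and div: "division_algebra F D"
    and iso: "algebra_isomorphic F A (matrix_algebra n D)"
  shows "prime_algebra A"
proof -
  interpret assoc_algebra F A
    by (rule A)
  interpret D: assoc_algebra F D
    using div by (simp add: division_algebra_def)
  let ?B = "matrix_algebra n D"
  obtain \<phi> where hom: "\<phi> \<in> module_hom F A ?B" and bij: "bij_betw \<phi> (carrier A) (carrier ?B)"
    and mult: "\<And>a b. a \<in> carrier A \<Longrightarrow> b \<in> carrier A \<Longrightarrow> \<phi> (a \<cdot> b) = \<phi> a \<otimes>\<^bsub>?B\<^esub> \<phi> b"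
    using iso by (auto simp: algebra_isomorphic_def)
  have closed: "\<phi> a \<in> carrier ?B" if "a \<in> carrier A" for a
    using bij that by (rule bij_betwE[rule_format])
  \<comment> \<open>No vector space structure on the matrices is established here, so
    \<open>\<phi>\<close> is seen to preserve zero through multiplication by the scalar zero,
    computed entrywise.\<close>
  have "\<phi> \<zero>\<^bsub>A\<^esub> = \<phi> (\<zero>\<^bsub>F\<^esub> \<odot>\<^bsub>A\<^esub> \<zero>\<^bsub>A\<^esub>)"
    by simp
  also have "\<dots> = \<zero>\<^bsub>F\<^esub> \<odot>\<^bsub>?B\<^esub> \<phi> \<zero>\<^bsub>A\<^esub>"
    by (rule module_hom_smult[OF hom]) auto
  also have "\<dots> = \<zero>\<^bsub>?B\<^esub>"
    using closed[OF M.zero_closed] by (auto simp: matrix_algebra_simps PiE_iff intro!: restrict_ext)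
  finally have zero: "\<phi> \<zero>\<^bsub>A\<^esub> = \<zero>\<^bsub>?B\<^esub>" .
  have nonzero: "\<phi> a \<noteq> \<zero>\<^bsub>?B\<^esub>" if "a \<in> carrier A" "a \<noteq> \<zero>\<^bsub>A\<^esub>" for a
    using that bij zero by (metis M.zero_closed bij_betw_imp_inj_on inj_on_eq_iff)
  show ?thesis
    unfolding prime_algebra_def
  proof (intro ballI impI, rule ccontr)
    fix a b
    assume a: "a \<in> carrier A" and b: "b \<in> carrier A"
      and 0: "{a \<cdot> x \<cdot> b | x. x \<in> carrier A} = {\<zero>\<^bsub>A\<^esub>}" and "\<not> (a = \<zero>\<^bsub>A\<^esub> \<or> b = \<zero>\<^bsub>A\<^esub>)"
    then obtain X where X: "X \<in> carrier ?B" "\<phi> a \<otimes>\<^bsub>?B\<^esub> X \<otimes>\<^bsub>?B\<^esub> \<phi> b \<noteq> \<zero>\<^bsub>?B\<^esub>"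
      using matrix_algebra_prime_witness[OF div closed[OF a] nonzero closed[OF b] nonzero] by blast
    then obtain x where x: "x \<in> carrier A" "X = \<phi> x"
      using bij by (auto simp: bij_betw_def)
    then have "\<phi> (a \<cdot> x \<cdot> b) \<noteq> \<zero>\<^bsub>?B\<^esub>"
      using X a b mult by simp
    moreover have "a \<cdot> x \<cdot> b = \<zero>\<^bsub>A\<^esub>"
      using 0 x by blast
    ultimately show False
      using zero by simp
  qed
qed

text \<open>The division algebra found from primeness is a corner of \<open>A\<close>, so it lives
  on the type \<open>'a\<close>. The converse must hold for every element type; since a formula
  cannot quantify over types, the second conjunct states it for a free type
  \<open>'d\<close>.\<close>

theorem theorem3p4:
  fixes F :: "('f, 'm) ring_scheme" and A :: "('f, 'a, 'e) module_scheme"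
  assumes "field F"
    and "assoc_algebra F A"
    and "vectorspace.fin_dim F A"
    and "carrier A \<noteq> {\<zero>\<^bsub>A\<^esub>}"
  shows "(prime_algebra A \<longleftrightarrow>
            (\<exists>n > 0. \<exists>D :: ('f, 'a) module.
               division_algebra F D \<and> algebra_isomorphic F A (matrix_algebra n D)))
       \<and> (\<forall>n > 0. \<forall>D :: ('f, 'd) module.
            division_algebra F D \<and> algebra_isomorphic F A (matrix_algebra n D)
              \<longrightarrow> prime_algebra A)"
proof (intro conjI iffI allI impI)
  assume "prime_algebra A"
  then show "\<exists>n > 0. \<exists>D :: ('f, 'a) module. division_algebra F D \<and> algebra_isomorphic F A (matrix_algebra n D)"
    using assoc_algebra.prime_imp_matrix_algebra assms by blast
qed (blast intro: prime_algebra_of_matrix_algebra[OF assms(2)])+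

end
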